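(* Let $m\ge 1$ and let $C_m$ be the cyclic biquandle of order $m$. For every integer $n\ge 1$, the $n$th Betti number of $C_m$, i.e. $\dim_{\mathbb{Q}} H^n_{YB}(C_m;\mathbb{Q})$, is equal to $m^{n-1}$.
   Context: The cyclic biquandle $C_m$ of order $m$ is the set $\mathbb{Z}/m\mathbb{Z}$ with the map $R(a,b)=(b+1,a-1)$. Its set-theoretic Yang-Baxter chain complex: for $n\ge 1$, $C_n^{YB}(C_m)$ is the free abelian group with basis $(C_m)^n$, and $C_n^{YB}(C_m)=0$ for $n\le 0$. The boundary is $\partial_n=\sum_{i=1}^n(-1)^{i-1}(d^l_{i,n}-d^r_{i,n})$ for $n\ge 2$ (and $\partial_n=0$ for $n\le 1$), where on basis elements $$d^l_{i,n}(x_1,\ldots,x_n)=(x_1-1,\ldots,x_{i-1}-1,x_{i+1},\ldots,x_n),$$ $$d^r_{i,n}(x_1,\ldots,x_n)=(x_1,\ldots,x_{i-1},x_{i+1}+1,\ldots,x_n+1).$$ For an abelian group $A$, $C^n_{YB}(C_m;A)=\mathrm{Hom}(C_n^{YB}(C_m),A)$ with $\delta^n f=f\circ\partial_{n+1}$, and $H^n_{YB}(C_m;A)$ is the cohomology of this cochain complex. *)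

theory Defs
  imports
    "HOL-Algebra.Free_Abelian_Groups"
    "HOL-Algebra.Elementary_Groups"
    "Jordan_Normal_Form.VS_Connect"
begin

text \<open>
  The cyclic biquandle of order \<open>m\<close> has underlying set \<open>carrier (integer_mod_group m)\<close>, which for
  \<open>m \<ge> 1\<close> is \<open>{0..<int m}\<close>.
\<close>

definition cyc_shift :: "nat \<Rightarrow> int \<Rightarrow> int \<Rightarrow> int" where
  "cyc_shift m k a = (a + k) mod int m"

definition cyc_R :: "nat \<Rightarrow> int \<times> int \<Rightarrow> int \<times> int" where
  "cyc_R m = (\<lambda>(a, b). (cyc_shift m 1 b, cyc_shift m (-1) a))"

definition YB_basis :: "nat \<Rightarrow> int \<Rightarrow> int list set" where
  "YB_basis m n =
     (if n \<ge> 1 then {xs. int (length xs) = n \<and> set xs \<subseteq> carrier (integer_mod_group m)} else {})"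

definition YB_chain :: "nat \<Rightarrow> int \<Rightarrow> (int list \<Rightarrow>\<^sub>0 int) monoid" where
  "YB_chain m n = free_Abelian_group (YB_basis m n)"

text \<open>
  The index \<open>i\<close> of a face map is 1-based. Both faces delete the \<open>i\<close>th entry after moving it out of
  the tuple by means of \<^const>\<open>cyc_R\<close>: moving it to the left end lowers the entries it passes, moving
  it to the right end raises them.
\<close>

definition YB_face_l :: "nat \<Rightarrow> nat \<Rightarrow> int list \<Rightarrow> int list" where
  "YB_face_l m i xs = map (cyc_shift m (-1)) (take (i - 1) xs) @ drop i xs"

definition YB_face_r :: "nat \<Rightarrow> nat \<Rightarrow> int list \<Rightarrow> int list" where
  "YB_face_r m i xs = take (i - 1) xs @ map (cyc_shift m 1) (drop i xs)"

definition YB_boundary :: "nat \<Rightarrow> int \<Rightarrow> (int list \<Rightarrow>\<^sub>0 int) \<Rightarrow> (int list \<Rightarrow>\<^sub>0 int)" where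
  "YB_boundary m n =
     (if n \<ge> 2 then
        frag_extend (\<lambda>xs. \<Sum>i = 1..nat n.
          frag_cmul ((-1) ^ (i - 1)) (frag_of (YB_face_l m i xs) - frag_of (YB_face_r m i xs)))
      else (\<lambda>_. 0))"

text \<open>
  The group \<open>Hom(C\<^sub>n, A)\<close> under pointwise operations. The library's \<^const>\<open>hom\<close> leaves the values
  outside the carrier arbitrary; intersecting with \<^const>\<open>extensional\<close> makes equality of elements
  equality of homomorphisms.
\<close>

definition YB_cochain ::
  "nat \<Rightarrow> ('a, 'b) monoid_scheme \<Rightarrow> int \<Rightarrow> ((int list \<Rightarrow>\<^sub>0 int) \<Rightarrow> 'a) monoid" where
  "YB_cochain m A n =
     \<lparr>carrier = hom (YB_chain m n) A \<inter> extensional (carrier (YB_chain m n)),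
      monoid.mult = (\<lambda>f g. \<lambda>c\<in>carrier (YB_chain m n). f c \<otimes>\<^bsub>A\<^esub> g c),
      one = (\<lambda>c\<in>carrier (YB_chain m n). \<one>\<^bsub>A\<^esub>)\<rparr>"

definition YB_coboundary ::
  "nat \<Rightarrow> int \<Rightarrow> ((int list \<Rightarrow>\<^sub>0 int) \<Rightarrow> 'a) \<Rightarrow> ((int list \<Rightarrow>\<^sub>0 int) \<Rightarrow> 'a)" where
  "YB_coboundary m n f = compose (carrier (YB_chain m (n + 1))) f (YB_boundary m (n + 1))"

definition YB_cocycles ::
  "nat \<Rightarrow> ('a, 'b) monoid_scheme \<Rightarrow> int \<Rightarrow> ((int list \<Rightarrow>\<^sub>0 int) \<Rightarrow> 'a) monoid" where
  "YB_cocycles m A n =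
     (YB_cochain m A n)
       \<lparr>carrier := kernel (YB_cochain m A n) (YB_cochain m A (n + 1)) (YB_coboundary m n)\<rparr>"

definition YB_coboundaries ::
  "nat \<Rightarrow> ('a, 'b) monoid_scheme \<Rightarrow> int \<Rightarrow> ((int list \<Rightarrow>\<^sub>0 int) \<Rightarrow> 'a) set" where
  "YB_coboundaries m A n = YB_coboundary m (n - 1) ` carrier (YB_cochain m A (n - 1))"

definition YB_cohomology ::
  "nat \<Rightarrow> ('a, 'b) monoid_scheme \<Rightarrow> int \<Rightarrow> ((int list \<Rightarrow>\<^sub>0 int) \<Rightarrow> 'a) set monoid" where
  "YB_cohomology m A n = YB_cocycles m A n Mod YB_coboundaries m A n"

text \<open>
  For a field \<open>K\<close>, the cohomology group with coefficients in the additive group of \<open>K\<close> as a vector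
  space over \<open>K\<close>, with \<open>q \<odot> (f + B) = q f + B\<close>. The image of the coset \<open>X\<close> under multiplication
  by \<open>q\<close> is \<open>q f + q B\<close>, which is only \<open>{0}\<close> if \<open>q = 0\<close>; hence the added \<open>B\<close>. The
  multiplicative fields of the record play no role in a module.
\<close>

definition YB_cohomology_space ::
  "('k, 'b) ring_scheme \<Rightarrow> nat \<Rightarrow> int \<Rightarrow> ('k, ((int list \<Rightarrow>\<^sub>0 int) \<Rightarrow> 'k) set) module" where
  "YB_cohomology_space K m n =
     \<lparr>carrier = carrier (YB_cohomology m (add_monoid K) n),
      mult = undefined,
      one = undefined,
      zero = \<one>\<^bsub>YB_cohomology m (add_monoid K) n\<^esub>,
      add = (\<otimes>\<^bsub>YB_cohomology m (add_monoid K) n\<^esub>),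
      smult = (\<lambda>q X. YB_coboundaries m (add_monoid K) n <#>\<^bsub>YB_cocycles m (add_monoid K) n\<^esub>
        (\<lambda>f. \<lambda>c\<in>carrier (YB_chain m n). q \<otimes>\<^bsub>K\<^esub> f c) ` X)\<rparr>"

definition YB_rational_cohomology ::
  "nat \<Rightarrow> int \<Rightarrow> (rat, ((int list \<Rightarrow>\<^sub>0 int) \<Rightarrow> rat) set) module" where
  "YB_rational_cohomology m n = YB_cohomology_space class_ring m n"

definition YB_betti :: "nat \<Rightarrow> int \<Rightarrow> nat" where
  "YB_betti m n = vectorspace.dim (class_ring :: rat ring) (YB_rational_cohomology m n)"

end

theory Submission
  imports Defs
begin

text \<open>
  Lowering all entries of the \<open>i\<close>th right face gives the \<open>i\<close>th left face. Let \<open>S\<close> be the operator of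
  order \<open>m\<close> on cochains induced by lowering all entries, and \<open>D\<close> the alternating sum of the duals of
  the right faces; then the coboundary is \<open>D (S - 1)\<close>, and \<open>S\<close> and \<open>D\<close> commute. After relabelling,
  \<open>D\<close> is the augmented simplicial coboundary of a full simplex, so \<open>D\<close> is exact.

  On the \<open>S\<close>-invariant cochains the coboundary vanishes. Let \<open>P\<close> be the average of the powers of
  \<open>S\<close>; then \<open>1 - P\<close> factors through \<open>S - 1\<close>. If \<open>F\<close> is a cocycle, then \<open>D F\<close> is invariant, so
  \<open>D (F - P F) = 0\<close> and \<open>F - P F = D h\<close> for some \<open>h\<close>; applying \<open>1 - P\<close> gives
  \<open>F - P F = D (h - P h) = D (S - 1) u\<close>, a coboundary. An invariant coboundary is killed by \<open>P\<close>,
  hence is \<open>0\<close>. So the cohomology is the space of \<open>S\<close>-invariant functions on \<open>n\<close>-tuples, and such a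
  function is determined by its arbitrary values on the \<open>m ^ (n - 1)\<close> tuples with first entry \<open>0\<close>.
  For \<open>n = 1\<close> the function \<open>h\<close> lives on the empty tuple, where \<open>S = 1\<close>, so that the argument also
  covers the absence of coboundaries.
\<close>

section \<open>Shifts of entries and the finite sets of tuples\<close>

lemma cyc_shift_cyc_shift [simp]: "cyc_shift m j (cyc_shift m k a) = cyc_shift m (j + k) a"
  by (simp add: cyc_shift_def mod_simps algebra_simps)

lemma cyc_shift_comp [simp]: "cyc_shift m j \<circ> cyc_shift m k = cyc_shift m (j + k)"
  by (simp add: fun_eq_iff)

definition cube :: "nat \<Rightarrow> nat \<Rightarrow> int list set" where
  "cube m N = {x. length x = N \<and> set x \<subseteq> {0..<int m}}"

lemma cube_0 [simp]: "cube m 0 = {[]}"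
  by (auto simp: cube_def)

lemma Cons_in_cube [simp]: "a # x \<in> cube m (Suc N) \<longleftrightarrow> a \<in> {0..<int m} \<and> x \<in> cube m N"
  by (auto simp: cube_def)

lemma in_cube_SucE:
  assumes "x \<in> cube m (Suc N)"
  obtains a y where "x = a # y" "a \<in> {0..<int m}" "y \<in> cube m N"
  using assms by (cases x) (auto simp: cube_def)

lemma finite_cube [simp]: "finite (cube m N)"
  and card_cube: "card (cube m N) = m ^ N"
proof -
  have eq: "cube m N = {x. set x \<subseteq> {0..<int m} \<and> length x = N}"
    by (auto simp: cube_def)
  show "finite (cube m N)"
    unfolding eq by (rule finite_lists_length_eq) simp
  show "card (cube m N) = m ^ N"
    unfolding eq by (subst card_lists_length_eq) auto
qed

lemma map_cyc_shift_in_cube [simp]: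
  assumes "m \<ge> 1" "x \<in> cube m N"
  shows "map (cyc_shift m k) x \<in> cube m N"
  using assms by (auto simp: cube_def cyc_shift_def)

lemma map_cyc_shift_mult_order [simp]:
  assumes "x \<in> cube m N"
  shows "map (cyc_shift m (int m * k)) x = x"
  using assms by (intro map_idI) (auto simp: cube_def cyc_shift_def)

lemma map_cyc_shift_order [simp]:
  assumes "x \<in> cube m N"
  shows "map (cyc_shift m 0) x = x" "map (cyc_shift m (- int m)) x = x"
  using map_cyc_shift_mult_order[OF assms, of 0] map_cyc_shift_mult_order[OF assms, of "-1"]
  by simp_all

section \<open>The dual of the right faces and its contraction\<close>

text \<open>
  The dual of the alternating sum of the right faces: the first right face of \<open>a # x\<close> shifts \<open>x\<close>,
  all others keep \<open>a\<close>.
\<close>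

fun rdiff :: "nat \<Rightarrow> (int list \<Rightarrow> 'a::comm_ring_1) \<Rightarrow> int list \<Rightarrow> 'a" where
  "rdiff m F [] = 0"
| "rdiff m F (a # x) = F (map (cyc_shift m 1) x) - rdiff m (\<lambda>y. F (a # y)) x"

text \<open>The face \<open>i = 1\<close> gives the leading term. The other faces keep the head, and
  lowering their index by one turns them into the faces of the tail with opposite signs.\<close>

lemma rdiff_eq_sum_faces:
  "rdiff m F x = (\<Sum>i = 1..length x. (-1) ^ (i - 1) * F (YB_face_r m i x))"
proof (induction x arbitrary: F)
  case (Cons a x)
  have "(\<Sum>i = 1..length (a # x). (-1) ^ (i - 1) * F (YB_face_r m i (a # x)))
      = F (map (cyc_shift m 1) x)
        + (\<Sum>i = 2..Suc (length x). (-1) ^ (i - 1) * F (YB_face_r m i (a # x)))"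
    by (subst sum.atLeast_Suc_atMost) (simp_all add: YB_face_r_def numeral_2_eq_2)
  also have "(\<Sum>i = 2..Suc (length x). (-1) ^ (i - 1) * F (YB_face_r m i (a # x)))
      = (\<Sum>i = 1..length x. (-1) ^ i * F (a # YB_face_r m i x))"
    unfolding numeral_2_eq_2 sum.shift_bounds_cl_Suc_ivl
    by (rule sum.cong)
       (auto simp: YB_face_r_def numeral_2_eq_2 Suc_le_eq gr0_conv_Suc)
  also have "\<dots> = - rdiff m (\<lambda>y. F (a # y)) x"
    unfolding Cons.IH sum_negf[symmetric]
    by (rule sum.cong) (auto simp: Suc_le_eq gr0_conv_Suc)
  finally show ?case by simp
qed simp

lemma rdiff_add: "rdiff m (\<lambda>y. F y + G y) x = rdiff m F x + rdiff m G x"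
  by (induction x arbitrary: F G) auto

lemma rdiff_diff: "rdiff m (\<lambda>y. F y - G y) x = rdiff m F x - rdiff m G x"
  by (induction x arbitrary: F G) auto

lemma rdiff_cmult: "rdiff m (\<lambda>y. c * F y) x = c * rdiff m F x"
  by (induction x arbitrary: F) (auto simp: algebra_simps)

lemma rdiff_zero [simp]: "rdiff m (\<lambda>y. 0) x = 0"
  using rdiff_cmult[of m 0 "\<lambda>_. 0" x] by simp

lemma rdiff_sum: "rdiff m (\<lambda>y. \<Sum>i\<in>I. F i y) x = (\<Sum>i\<in>I. rdiff m (F i) x)"
  by (induction I rule: infinite_finite_induct) (simp_all add: rdiff_add)

text \<open>The right faces of a tuple in \<open>cube m (Suc N)\<close> lie in
  \<open>cube m N\<close>, so only values there enter.\<close>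

lemma rdiff_cong:
  assumes "m \<ge> 1" "x \<in> cube m (Suc N)" "\<And>y. y \<in> cube m N \<Longrightarrow> F y = G y"
  shows "rdiff m F x = rdiff m G x"
  using assms(2,3)
proof (induction N arbitrary: x F G)
  case 0
  then show ?case by (auto elim!: in_cube_SucE)
next
  case (Suc N)
  from Suc.prems(1) obtain a y where x: "x = a # y" "a \<in> {0..<int m}" "y \<in> cube m (Suc N)"
    by (rule in_cube_SucE)
  have "rdiff m (\<lambda>z. F (a # z)) y = rdiff m (\<lambda>z. G (a # z)) y"
    using x Suc.prems(2) by (intro Suc.IH) auto
  with x assms(1) Suc.prems(2) show ?case by simp
qed

text \<open>Shifting all entries commutes with the right faces; this is the commutation of
  \<open>D\<close> with every power of \<open>S\<close>.\<close>

lemma rdiff_map_cyc_shift: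
  "rdiff m (\<lambda>y. F (map (cyc_shift m k) y)) x = rdiff m F (map (cyc_shift m k) x)"
proof (induction x arbitrary: F)
  case (Cons a x)
  show ?case
    using Cons.IH[of "\<lambda>z. F (cyc_shift m k a # z)"] by (simp add: add.commute)
qed simp

text \<open>
  The right faces are, up to relabelling, those of a full simplex, so coning with \<open>0\<close> contracts
  the augmented complex.
\<close>

lemma rdiff_cone:
  assumes "m \<ge> 1" "x \<in> cube m N" "\<And>y. y \<in> cube m (Suc N) \<Longrightarrow> rdiff m g y = 0"
  shows "rdiff m (\<lambda>y. g (0 # map (cyc_shift m (-1)) y)) x = g x"
proof -
  \<comment> \<open>Lowering \<open>x\<close> cancels the raising in the first right face, so that
    face of the coned tuple is \<open>x\<close> itself.\<close>
  have "0 # map (cyc_shift m (-1)) x \<in> cube m (Suc N)"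
    using assms(1,2) by simp
  from assms(3)[OF this]
  have "g (map (cyc_shift m 0) x) = rdiff m (\<lambda>y. g (0 # y)) (map (cyc_shift m (-1)) x)"
    by simp
  also have "\<dots> = rdiff m (\<lambda>y. g (0 # map (cyc_shift m (-1)) y)) x"
    by (rule rdiff_map_cyc_shift[symmetric])
  finally show ?thesis using assms(2) by simp
qed

section \<open>The coboundary as a product of commuting operators\<close>

definition YB_diff :: "nat \<Rightarrow> (int list \<Rightarrow> 'a::comm_ring_1) \<Rightarrow> int list \<Rightarrow> 'a" where
  "YB_diff m F = rdiff m (\<lambda>y. F (map (cyc_shift m (-1)) y) - F y)"

text \<open>The form \<open>(S - 1) D\<close> of \<open>D (S - 1)\<close>. It shows that
  \<open>D F\<close> is invariant for a cocycle \<open>F\<close> and that averaging kills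
  coboundaries.\<close>

lemma YB_diff_eq:
  "YB_diff m F x = rdiff m F (map (cyc_shift m (-1)) x) - rdiff m F x"
  by (simp only: YB_diff_def rdiff_diff rdiff_map_cyc_shift)

text \<open>Lowering a right face lowers the entries before position \<open>i\<close> and undoes the
  raising of those after it, which leaves the left face.\<close>

lemma YB_diff_eq_sum_faces:
  assumes "m \<ge> 1" "x \<in> cube m N"
  shows "YB_diff m F x
      = (\<Sum>i = 1..N. (-1) ^ (i - 1) * (F (YB_face_l m i x) - F (YB_face_r m i x)))"
proof -
  have N: "length x = N" using assms(2) by (simp add: cube_def)
  have "map (cyc_shift m (-1)) (YB_face_r m i x) = YB_face_l m i x" for i
  proof -
    have "cyc_shift m 0 a = a" if "a \<in> set (drop i x)" for a
      using assms(2) in_set_dropD[OF that] by (auto simp: cube_def cyc_shift_def)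
    then show ?thesis
      by (auto simp: YB_face_l_def YB_face_r_def intro!: map_idI)
  qed
  then show ?thesis
    by (simp add: YB_diff_def rdiff_eq_sum_faces N)
qed

lemma YB_diff_add: "YB_diff m (\<lambda>y. F y + G y) x = YB_diff m F x + YB_diff m G x"
  by (simp add: YB_diff_eq rdiff_add)

lemma YB_diff_diff: "YB_diff m (\<lambda>y. F y - G y) x = YB_diff m F x - YB_diff m G x"
  by (simp add: YB_diff_eq rdiff_diff)

lemma YB_diff_cmult: "YB_diff m (\<lambda>y. c * F y) x = c * YB_diff m F x"
  by (simp add: YB_diff_eq rdiff_cmult algebra_simps)

lemma YB_diff_zero [simp]: "YB_diff m (\<lambda>y. 0) x = 0"
  by (simp add: YB_diff_eq)

text \<open>The only face is the empty tuple, which every shift fixes. This matches the vanishing of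
  coboundaries in degree 1.\<close>

lemma YB_diff_singleton [simp]: "YB_diff m F [a] = 0"
  by (simp add: YB_diff_def)

section \<open>Averaging over the cyclic shifts\<close>

definition cyc_average :: "nat \<Rightarrow> (int list \<Rightarrow> 'a::field_char_0) \<Rightarrow> int list \<Rightarrow> 'a" where
  "cyc_average m F x = (\<Sum>j<m. F (map (cyc_shift m (- int j)) x)) / of_nat m"

definition cyc_invariant :: "nat \<Rightarrow> nat \<Rightarrow> (int list \<Rightarrow> 'a) \<Rightarrow> bool" where
  "cyc_invariant m N F \<longleftrightarrow> (\<forall>x\<in>cube m N. \<forall>k. F (map (cyc_shift m k) x) = F x)"

text \<open>Lowering by 1 generates all shifts, since modulo \<open>m\<close> every integer is the
  negative of a natural number.\<close>

lemma cyc_invariantI: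
  assumes m: "m \<ge> 1"
    and step: "\<And>x. x \<in> cube m N \<Longrightarrow> F (map (cyc_shift m (-1)) x) = F x"
  shows "cyc_invariant m N F"
proof -
  have *: "F (map (cyc_shift m (- int j)) x) = F x" if "x \<in> cube m N" for j x
  proof (induction j)
    case 0
    then show ?case using that by simp
  next
    case (Suc j)
    have "F (map (cyc_shift m (- int (Suc j))) x)
        = F (map (cyc_shift m (-1)) (map (cyc_shift m (- int j)) x))"
      by (simp add: algebra_simps)
    also have "\<dots> = F (map (cyc_shift m (- int j)) x)"
      using m that by (intro step) simp
    finally show ?case using Suc by simp
  qed
  show ?thesis
    unfolding cyc_invariant_def
  proof (intro ballI allI)
    fix x k assume x: "x \<in> cube m N"
    have "cyc_shift m k = cyc_shift m (- int (nat ((- k) mod int m)))"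
      using m by (auto simp: cyc_shift_def fun_eq_iff mod_simps)
    then show "F (map (cyc_shift m k) x) = F x"
      using *[OF x] by metis
  qed
qed

text \<open>The difference of the two sums telescopes to the terms for \<open>m\<close> and
  \<open>0\<close>, which agree because the shift has order \<open>m\<close>.\<close>

lemma sum_cyc_rotate:
  fixes F :: "int list \<Rightarrow> 'a::ab_group_add"
  assumes "m \<ge> 1" "x \<in> cube m N"
  shows "(\<Sum>j<m. F (map (cyc_shift m (- int (Suc j))) x)) = (\<Sum>j<m. F (map (cyc_shift m (- int j)) x))"
    (is "?L = ?R")
proof -
  have "?L - ?R = (\<Sum>j<m. F (map (cyc_shift m (- int (Suc j))) x) - F (map (cyc_shift m (- int j)) x))"
    by (simp add: sum_subtractf)
  also have "\<dots> = F (map (cyc_shift m (- int m)) x) - F (map (cyc_shift m (- int 0)) x)"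
    by (rule sum_lessThan_telescope)
  also have "\<dots> = 0" using assms by simp
  finally show ?thesis by simp
qed

lemma cyc_invariant_cyc_average:
  assumes "m \<ge> 1"
  shows "cyc_invariant m N (cyc_average m F)"
  using sum_cyc_rotate[OF assms, of _ N F]
  by (intro cyc_invariantI assms) (simp add: cyc_average_def algebra_simps)

lemma cyc_average_invariant:
  assumes "m \<ge> 1" "cyc_invariant m N F" "x \<in> cube m N"
  shows "cyc_average m F x = F x"
  using assms by (simp add: cyc_average_def cyc_invariant_def)

text \<open>\<open>D\<close> is linear and commutes with each shift, hence with their
  average.\<close>

lemma rdiff_cyc_average: "rdiff m (cyc_average m F) x = cyc_average m (rdiff m F) x"
proof -
  have "rdiff m (cyc_average m F) x
      = rdiff m (\<lambda>y. (1 / of_nat m) * (\<Sum>j<m. F (map (cyc_shift m (- int j)) y))) x"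
    by (intro arg_cong2[where f = "rdiff m"]) (auto simp: cyc_average_def)
  then show ?thesis
    by (simp only: rdiff_cmult rdiff_sum rdiff_map_cyc_shift) (simp add: cyc_average_def)
qed

text \<open>The witness is \<open>u = (1/m) \<Sum>\<^sub>j j S\<^sup>j h\<close>, with \<open>S\<close> the operator \<open>h \<mapsto> h \<circ> map (cyc_shift m (-1))\<close>.\<close>

lemma minus_cyc_average_eq_shift_minus:
  assumes m: "m \<ge> 1"
  obtains u where
    "\<And>x N. x \<in> cube m N \<Longrightarrow> h x - cyc_average m h x = u (map (cyc_shift m (-1)) x) - u x"
proof
  fix x N assume x: "x \<in> cube m N"
  define a where "a = (\<lambda>j. h (map (cyc_shift m (- int j)) x))"
  have a_m: "a m = a 0" using x by (simp add: a_def)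
  \<comment> \<open>Summation by parts: the left side is \<open>(S - 1)\<close> applied to
    \<open>m u\<close>, evaluated at \<open>x\<close>.\<close>
  have "(\<Sum>j<m. of_nat j * a (Suc j)) - (\<Sum>j<m. of_nat j * a j)
      = (\<Sum>j<m. (of_nat (Suc j) * a (Suc j) - of_nat j * a j) - a (Suc j))"
    by (simp add: sum_subtractf[symmetric] algebra_simps)
  also have "\<dots> = of_nat m * a m - (\<Sum>j<m. a (Suc j))"
    by (subst sum_subtractf, subst sum_lessThan_telescope) simp
  also have "(\<Sum>j<m. a (Suc j)) = (\<Sum>j<m. a j)"
    using sum_cyc_rotate[OF m x, of h] by (simp only: a_def)
  finally have "(\<Sum>j<m. of_nat j * a (Suc j)) - (\<Sum>j<m. of_nat j * a j) = of_nat m * a 0 - (\<Sum>j<m. a j)"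
    by (simp add: a_m)
  moreover have "h x = a 0" using x by (simp add: a_def)
  \<comment> \<open>The right side of this equation instantiates the witness
    \<open>u\<close>.\<close>
  ultimately show "h x - cyc_average m h x
      = (\<Sum>j<m. of_nat j * h (map (cyc_shift m (- int j)) (map (cyc_shift m (-1)) x))) / of_nat m
        - (\<Sum>j<m. of_nat j * h (map (cyc_shift m (- int j)) x)) / of_nat m"
    using m by (simp add: cyc_average_def a_def field_simps)
qed

lemma YB_cocycle_minus_average_exact:
  assumes m: "m \<ge> 1" and N: "N \<ge> 1"
    and F: "\<And>x. x \<in> cube m (Suc N) \<Longrightarrow> YB_diff m F x = 0"
  obtains u where "\<And>x. x \<in> cube m N \<Longrightarrow> F x - cyc_average m F x = YB_diff m u x"
proof -
  from N obtain M where M: "N = Suc M" by (cases N) auto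
  define g where "g = (\<lambda>x. F x - cyc_average m F x)"
  have inv: "cyc_invariant m (Suc N) (rdiff m F)"
    using F by (intro cyc_invariantI m) (simp add: YB_diff_eq)
  have dg: "rdiff m g x = 0" if "x \<in> cube m (Suc N)" for x
    using cyc_average_invariant[OF m inv that]
    by (simp add: g_def rdiff_diff rdiff_cyc_average)
  \<comment> \<open>Coning gives a preimage of \<open>g\<close> under \<open>D\<close>, defined on
    tuples one entry shorter.\<close>
  define h where "h = (\<lambda>y. g (0 # map (cyc_shift m (-1)) y))"
  have h: "rdiff m h x = g x" if "x \<in> cube m N" for x
    unfolding h_def by (rule rdiff_cone[OF m that dg])
  from minus_cyc_average_eq_shift_minus[OF m, of h]
  obtain u where u: "\<And>x N. x \<in> cube m N \<Longrightarrow>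
      h x - cyc_average m h x = u (map (cyc_shift m (-1)) x) - u x"
    by blast
  have "g x = YB_diff m u x" if x: "x \<in> cube m N" for x
  proof -
    \<comment> \<open>The identity for \<open>u\<close> is applied to tuples of length
      \<open>M\<close>; for \<open>M = 0\<close> this is the empty tuple.\<close>
    have "YB_diff m u x = rdiff m (\<lambda>y. h y - cyc_average m h y) x"
      unfolding YB_diff_def using x M by (intro rdiff_cong[OF m]) (auto simp: u)
    also have "\<dots> = g x - cyc_average m (rdiff m h) x"
      using h[OF x] by (simp add: rdiff_diff rdiff_cyc_average)
    \<comment> \<open>The average only involves shifts of \<open>x\<close>, which stay in
      \<open>cube m N\<close>, where \<open>D h = g\<close>.\<close>
    also have "cyc_average m (rdiff m h) x = cyc_average m g x"
      using h x m by (simp add: cyc_average_def)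
    also have "\<dots> = cyc_average m F x - cyc_average m (cyc_average m F) x"
      by (simp add: cyc_average_def g_def sum_subtractf diff_divide_distrib)
    also have "\<dots> = 0"
      by (simp add: cyc_average_invariant[OF m cyc_invariant_cyc_average[OF m] x])
    finally show ?thesis by simp
  qed
  with that show ?thesis unfolding g_def by blast
qed

lemma cyc_invariant_exact_eq_0:
  fixes F :: "int list \<Rightarrow> 'a::field_char_0"
  assumes m: "m \<ge> 1" and inv: "cyc_invariant m N F"
    and F: "\<And>x. x \<in> cube m N \<Longrightarrow> F x = YB_diff m u x"
    and x: "x \<in> cube m N"
  shows "F x = 0"
proof -
  have "F x = cyc_average m F x"
    using cyc_average_invariant[OF m inv x] by simp
  also have "\<dots> = (\<Sum>j<m. YB_diff m u (map (cyc_shift m (- int j)) x)) / of_nat m"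
    using m x by (simp add: cyc_average_def F)
  also have "\<dots> = 0"
    \<comment> \<open>By \<open>YB_diff_eq\<close> the sum is the difference of two sums that are
      rotations of each other.\<close>
    using sum_cyc_rotate[OF m x, of "rdiff m u"]
    by (simp add: YB_diff_eq sum_subtractf algebra_simps)
  finally show ?thesis .
qed

lemma YB_diff_cyc_invariant:
  assumes m: "m \<ge> 1" and "cyc_invariant m N F" and x: "x \<in> cube m (Suc N)"
  shows "YB_diff m F x = 0"
proof -
  have "YB_diff m F x = rdiff m (\<lambda>_. 0) x"
    unfolding YB_diff_def using assms by (intro rdiff_cong[OF m x]) (simp add: cyc_invariant_def)
  then show ?thesis by simp
qed

section \<open>Invariant functions and their values on tuples starting with \<open>0\<close>\<close>

definition cyc_extend :: "nat \<Rightarrow> (int list \<Rightarrow> 'a) \<Rightarrow> int list \<Rightarrow> 'a" where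
  "cyc_extend m w x = w (map (cyc_shift m (- hd x)) (tl x))"

lemma cyc_invariant_cyc_extend: "cyc_invariant m (Suc N) (cyc_extend m w)"
proof -
  \<comment> \<open>Shifting by \<open>k\<close> moves head and tail alike, so the tail relative to
    the head is unchanged.\<close>
  have "cyc_shift m (k - cyc_shift m k a) = cyc_shift m (- a)" for k a
    by (simp add: cyc_shift_def fun_eq_iff mod_simps algebra_simps)
  then show ?thesis
    by (auto simp: cyc_invariant_def cyc_extend_def comp_def elim!: in_cube_SucE)
qed

text \<open>Shifting by minus the first entry moves \<open>x\<close> to the tuple of its orbit that
  starts with \<open>0\<close>.\<close>

lemma cyc_invariant_eq_cyc_extend:
  assumes "m \<ge> 1" "cyc_invariant m (Suc N) F" "x \<in> cube m (Suc N)"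
  shows "F x = cyc_extend m (\<lambda>y. F (0 # y)) x"
proof -
  from assms(3) obtain a y where x: "x = a # y" by (rule in_cube_SucE)
  have "F x = F (map (cyc_shift m (- a)) x)"
    using assms by (simp add: cyc_invariant_def)
  then show ?thesis by (simp add: x cyc_extend_def cyc_shift_def)
qed

lemma cyc_extend_Cons_0:
  assumes "y \<in> cube m N"
  shows "cyc_extend m w (0 # y) = w y"
  using assms by (simp add: cyc_extend_def)

section \<open>Linear extension from a basis to the free abelian group\<close>

definition frag_eval :: "('b \<Rightarrow> 'a::comm_ring_1) \<Rightarrow> ('b \<Rightarrow>\<^sub>0 int) \<Rightarrow> 'a" where
  "frag_eval F c = (\<Sum>x\<in>Poly_Mapping.keys c. of_int (Poly_Mapping.lookup c x) * F x)"

lemma frag_eval_eq_sum: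
  assumes "finite I" "Poly_Mapping.keys c \<subseteq> I"
  shows "frag_eval F c = (\<Sum>x\<in>I. of_int (Poly_Mapping.lookup c x) * F x)"
  unfolding frag_eval_def using assms
  by (intro sum.mono_neutral_left) (auto simp: in_keys_iff)

lemma frag_eval_0 [simp]: "frag_eval F 0 = 0"
  by (simp add: frag_eval_def)

lemma frag_eval_frag_of [simp]: "frag_eval F (frag_of x) = F x"
  by (simp add: frag_eval_def)

lemma frag_eval_add: "frag_eval F (a + b) = frag_eval F a + frag_eval F b"
proof -
  let ?I = "Poly_Mapping.keys a \<union> Poly_Mapping.keys b"
  have "Poly_Mapping.keys (a + b) \<subseteq> ?I" by (rule keys_add)
  then show ?thesis
    by (simp add: frag_eval_eq_sum[of ?I] lookup_add sum.distrib distrib_right)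
qed

lemma frag_eval_cmul: "frag_eval F (frag_cmul k a) = of_int k * frag_eval F a"
proof -
  have "Poly_Mapping.keys (frag_cmul k a) \<subseteq> Poly_Mapping.keys a" by (rule keys_cmul)
  then show ?thesis
    by (simp add: frag_eval_eq_sum[of "Poly_Mapping.keys a"] sum_distrib_left mult.assoc)
qed

lemma frag_eval_diff: "frag_eval F (a - b) = frag_eval F a - frag_eval F b"
  using frag_eval_add[of F a "frag_cmul (-1) b"] frag_eval_cmul[of F "-1" b] by simp

lemma frag_eval_sum: "frag_eval F (\<Sum>i\<in>I. a i) = (\<Sum>i\<in>I. frag_eval F (a i))"
  by (induction I rule: infinite_finite_induct) (simp_all add: frag_eval_add)

lemma frag_eval_frag_extend: "frag_eval F (frag_extend g c) = frag_eval (\<lambda>x. frag_eval F (g x)) c"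
  unfolding frag_extend_def frag_eval_sum frag_eval_cmul by (simp add: frag_eval_def)

lemma frag_eval_cong:
  "(\<And>x. x \<in> Poly_Mapping.keys c \<Longrightarrow> F x = G x) \<Longrightarrow> frag_eval F c = frag_eval G c"
  by (simp add: frag_eval_def)

lemma frag_eval_plus: "frag_eval (\<lambda>x. F x + G x) c = frag_eval F c + frag_eval G c"
  by (simp add: frag_eval_def sum.distrib distrib_left)

lemma frag_eval_mult: "frag_eval (\<lambda>x. q * F x) c = q * frag_eval F c"
  by (simp add: frag_eval_def sum_distrib_left mult.left_commute)

lemma frag_eval_zero [simp]: "frag_eval (\<lambda>x. 0) c = 0"
  by (simp add: frag_eval_def)

text \<open>The simplifier's normal form of \<open>add_monoid class_ring\<close>.\<close>

abbreviation additive_monoid :: "'a::comm_ring_1 monoid" where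
  "additive_monoid \<equiv> \<lparr>carrier = UNIV, monoid.mult = (+), one = 0\<rparr>"

lemma hom_free_Abelian_group_eq_frag_eval:
  assumes "f \<in> hom (free_Abelian_group S) (additive_monoid :: 'a::comm_ring_1 monoid)"
    and "Poly_Mapping.keys c \<subseteq> S"
  shows "f c = frag_eval (\<lambda>x. f (frag_of x)) c"
proof -
  have add: "f (a + b) = f a + f b" if "Poly_Mapping.keys a \<subseteq> S" "Poly_Mapping.keys b \<subseteq> S" for a b
    using hom_mult[OF assms(1), of a b] that by (simp add: free_Abelian_group_def)
  have zero: "f 0 = 0"
    using add[of 0 0] by simp
  have sub: "f (a - b) = f a - f b" if "Poly_Mapping.keys a \<subseteq> S" "Poly_Mapping.keys b \<subseteq> S" for a b
  proof -
    have "Poly_Mapping.keys (a - b) \<subseteq> S"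
      using that keys_diff[of a b] by blast
    then show ?thesis
      using add[of "a - b" b] that by simp
  qed
  \<comment> \<open>The support condition is carried through the induction because \<open>f\<close>
    is only known to be additive on chains supported in \<open>S\<close>.\<close>
  have "Poly_Mapping.keys c \<subseteq> S \<and> f c = frag_eval (\<lambda>x. f (frag_of x)) c"
    using assms(2)
  proof (induction c rule: frag_induction)
    case (diff a b)
    then show ?case
      using sub[of a b] keys_diff[of a b] by (auto simp: frag_eval_diff)
  qed (simp_all add: zero)
  then show ?thesis ..
qed

section \<open>Cochains, cocycles and coboundaries as functions on tuples\<close>

context
  fixes m :: nat
  assumes m: "m \<ge> 1"
begin

text \<open>The bound on \<open>N\<close> matters: the chain group in degree 0 is trivial, whereas
  \<open>cube m 0\<close> contains the empty tuple.\<close>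

lemma carrier_YB_chain:
  "N \<ge> 1 \<Longrightarrow> carrier (YB_chain m (int N)) = {c. Poly_Mapping.keys c \<subseteq> cube m N}"
  using m
  by (simp add: YB_chain_def free_Abelian_group_def YB_basis_def cube_def carrier_integer_mod_group)

definition YB_cochain_of :: "nat \<Rightarrow> (int list \<Rightarrow> 'a::comm_ring_1) \<Rightarrow> (int list \<Rightarrow>\<^sub>0 int) \<Rightarrow> 'a" where
  "YB_cochain_of N F = restrict (frag_eval F) (carrier (YB_chain m (int N)))"

lemma YB_cochain_of_eq_iff:
  assumes "N \<ge> 1"
  shows "YB_cochain_of N F = YB_cochain_of N G \<longleftrightarrow> (\<forall>x\<in>cube m N. F x = G x)"
proof
  assume eq: "YB_cochain_of N F = YB_cochain_of N G"
  show "\<forall>x\<in>cube m N. F x = G x"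
  proof
    fix x assume "x \<in> cube m N"
    then show "F x = G x"
      using fun_cong[OF eq, of "frag_of x"] assms
      by (simp add: YB_cochain_of_def carrier_YB_chain keys_frag_of)
  qed
next
  assume "\<forall>x\<in>cube m N. F x = G x"
  with assms show "YB_cochain_of N F = YB_cochain_of N G"
    unfolding YB_cochain_of_def
    by (intro restrict_ext frag_eval_cong) (auto simp: carrier_YB_chain)
qed

lemma carrier_YB_cochain:
  assumes "N \<ge> 1"
  shows "carrier (YB_cochain m (additive_monoid :: 'a::comm_ring_1 monoid) (int N))
      = range (YB_cochain_of N)" (is "?L = ?R")
proof (intro equalityI subsetI)
  fix f assume "f \<in> ?L"
  then have f: "f \<in> hom (YB_chain m (int N)) (additive_monoid :: 'a monoid)"
      "f \<in> extensional (carrier (YB_chain m (int N)))"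
    by (auto simp: YB_cochain_def)
  have "f = YB_cochain_of N (\<lambda>x. f (frag_of x))"
  proof (rule extensionalityI[OF f(2)])
    show "YB_cochain_of N (\<lambda>x. f (frag_of x)) \<in> extensional (carrier (YB_chain m (int N)))"
      by (simp add: YB_cochain_of_def)
    fix c assume c: "c \<in> carrier (YB_chain m (int N))"
    then show "f c = YB_cochain_of N (\<lambda>x. f (frag_of x)) c"
      using hom_free_Abelian_group_eq_frag_eval[of f "YB_basis m (int N)" c] f(1)
      by (simp add: YB_cochain_of_def YB_chain_def free_Abelian_group_def)
  qed
  then show "f \<in> ?R" by blast
next
  fix f assume "f \<in> ?R"
  then obtain F where f: "f = YB_cochain_of N F" by blast
  have "Poly_Mapping.keys (a + b) \<subseteq> YB_basis m (int N)"
    if "Poly_Mapping.keys a \<subseteq> YB_basis m (int N)" "Poly_Mapping.keys b \<subseteq> YB_basis m (int N)"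
    for a b :: "int list \<Rightarrow>\<^sub>0 int"
    using that keys_add[of a b] by blast
  then show "f \<in> ?L"
    by (auto simp: f YB_cochain_def YB_cochain_of_def hom_def frag_eval_add YB_chain_def
        free_Abelian_group_def)
qed

lemma YB_cochain_of_mult:
  "YB_cochain_of N F \<otimes>\<^bsub>YB_cochain m additive_monoid (int N)\<^esub> YB_cochain_of N G
    = YB_cochain_of N (\<lambda>x. F x + G x)"
  by (auto simp: YB_cochain_def YB_cochain_of_def frag_eval_plus)

lemma YB_cochain_of_smult:
  "(\<lambda>c\<in>carrier (YB_chain m (int N)). q * YB_cochain_of N F c)
    = YB_cochain_of N (\<lambda>x. q * F x)"
  by (auto simp: YB_cochain_of_def frag_eval_mult)

lemma one_YB_cochain:
  "\<one>\<^bsub>YB_cochain m additive_monoid (int N)\<^esub> = YB_cochain_of N (\<lambda>x. 0)"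
  by (auto simp: YB_cochain_def YB_cochain_of_def)

text \<open>Evaluating \<open>F\<close> on the boundary of a basis tuple gives
  \<open>YB_diff\<close>, and linearity extends this to all chains.\<close>

lemma YB_coboundary_YB_cochain_of:
  assumes "N \<ge> 1"
  shows "YB_coboundary m (int N) (YB_cochain_of N F) = YB_cochain_of (Suc N) (YB_diff m F)"
proof -
  have face: "YB_face_l m i x \<in> cube m N" "YB_face_r m i x \<in> cube m N"
    if "x \<in> cube m (Suc N)" "i \<in> {1..Suc N}" for i x
    using that m
    by (auto simp: cube_def YB_face_l_def YB_face_r_def cyc_shift_def
        dest!: in_set_takeD in_set_dropD)
  \<comment> \<open>Membership in the carrier is needed because \<open>YB_cochain_of\<close> is
    restricted to it.\<close>
  have bdry: "YB_boundary m (int N + 1) c \<in> carrier (YB_chain m (int N))"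
    "frag_eval F (YB_boundary m (int N + 1) c) = frag_eval (YB_diff m F) c"
    if c: "c \<in> carrier (YB_chain m (int (Suc N)))" for c
  proof -
    define d where "d = (\<lambda>x. \<Sum>i = 1..Suc N.
      frag_cmul ((-1) ^ (i - 1)) (frag_of (YB_face_l m i x) - frag_of (YB_face_r m i x)))"
    have eq: "YB_boundary m (int N + 1) c = frag_extend d c"
      using assms by (simp add: YB_boundary_def d_def nat_add_distrib)
    have keys: "Poly_Mapping.keys c \<subseteq> cube m (Suc N)"
      using c carrier_YB_chain[of "Suc N"] by simp
    have "Poly_Mapping.keys (d x) \<subseteq> cube m N" if x: "x \<in> cube m (Suc N)" for x
    proof -
      have "Poly_Mapping.keys (frag_of (YB_face_l m i x) - frag_of (YB_face_r m i x)) \<subseteq> cube m N"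
        if "i \<in> {1..Suc N}" for i
        using face[OF x that] keys_diff[of "frag_of (YB_face_l m i x)" "frag_of (YB_face_r m i x)"]
        by (auto simp: keys_frag_of)
      then show ?thesis
        unfolding d_def
        by (intro order_trans[OF keys_sum] UN_least order_trans[OF keys_cmul])
    qed
    then show "YB_boundary m (int N + 1) c \<in> carrier (YB_chain m (int N))"
      unfolding eq using keys keys_frag_extend[of d c] assms by (simp add: carrier_YB_chain) blast
    have "frag_eval F (d x) = YB_diff m F x" if "x \<in> cube m (Suc N)" for x
      unfolding YB_diff_eq_sum_faces[OF m that] d_def frag_eval_sum frag_eval_cmul frag_eval_diff
      by simp
    then show "frag_eval F (YB_boundary m (int N + 1) c) = frag_eval (YB_diff m F) c"
      unfolding eq frag_eval_frag_extend using keys by (intro frag_eval_cong) auto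
  qed
  then show ?thesis
    by (auto simp: YB_coboundary_def YB_cochain_of_def compose_def add.commute)
qed

lemma carrier_YB_cocycles:
  assumes "N \<ge> 1"
  shows "carrier (YB_cocycles m (additive_monoid :: 'a::comm_ring_1 monoid) (int N))
      = YB_cochain_of N ` {F. \<forall>x\<in>cube m (Suc N). YB_diff m F x = 0}"
proof -
  have "\<one>\<^bsub>YB_cochain m (additive_monoid :: 'a monoid) (int N + 1)\<^esub>
      = YB_cochain_of (Suc N) (\<lambda>x. 0)"
    using one_YB_cochain[of "Suc N"] by (simp add: add.commute)
  then show ?thesis
    using assms
    by (auto simp: YB_cocycles_def kernel_def carrier_YB_cochain YB_coboundary_YB_cochain_of
        YB_cochain_of_eq_iff)
qed

text \<open>In degree 1 the left side comes from the trivial chain group and the right side from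
  functions on the empty tuple; both consist of the zero cochain alone.\<close>

lemma YB_coboundaries_eq:
  assumes "N \<ge> 1"
  shows "YB_coboundaries m (additive_monoid :: 'a::comm_ring_1 monoid) (int N)
      = range (\<lambda>u. YB_cochain_of N (YB_diff m u))"
proof (cases "N = 1")
  case False
  with assms obtain M where M: "N = Suc M" "M \<ge> 1" by (cases N) auto
  then have "int N - 1 = int M" by simp
  then show ?thesis
    using M
    by (simp add: YB_coboundaries_def carrier_YB_cochain YB_coboundary_YB_cochain_of image_image)
next
  case True
  let ?Z = "YB_cochain_of 1 (\<lambda>x. 0 :: 'a)"
  have chain0: "carrier (YB_chain m 0) = {0}"
    by (auto simp: YB_chain_def YB_basis_def free_Abelian_group_def)
  have "YB_coboundary m 0 f = ?Z"
    if "f \<in> carrier (YB_cochain m (additive_monoid :: 'a monoid) 0)" for f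
  proof -
    have "f 0 = f (0 + 0)" by simp
    also have "\<dots> = f 0 + f 0"
      using that hom_mult[of f "YB_chain m 0" "additive_monoid :: 'a monoid" 0 0] chain0
      by (simp add: YB_cochain_def YB_chain_def free_Abelian_group_def)
    finally show ?thesis
      by (auto simp: YB_coboundary_def YB_boundary_def YB_cochain_of_def compose_def)
  qed
  moreover have "(\<lambda>c\<in>{0}. 0) \<in> carrier (YB_cochain m (additive_monoid :: 'a monoid) 0)"
    using chain0 by (auto simp: YB_cochain_def hom_def YB_chain_def free_Abelian_group_def)
  ultimately have "YB_coboundaries m (additive_monoid :: 'a monoid) (int N) = {?Z}"
    using True by (auto simp: YB_coboundaries_def image_iff)
  moreover have "YB_cochain_of N (YB_diff m u) = ?Z" for u :: "int list \<Rightarrow> 'a"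
    unfolding True by (subst YB_cochain_of_eq_iff) (auto elim!: in_cube_SucE)
  ultimately show ?thesis by auto
qed

section \<open>Cohomology classes and their vector space operations\<close>

definition YB_class :: "nat \<Rightarrow> (int list \<Rightarrow> 'a::comm_ring_1) \<Rightarrow> ((int list \<Rightarrow>\<^sub>0 int) \<Rightarrow> 'a) set" where
  "YB_class N F = range (\<lambda>u. YB_cochain_of N (\<lambda>x. F x + YB_diff m u x))"

text \<open>By additivity of \<open>YB_diff\<close>, replacing the parameter \<open>u\<close> by
  \<open>v + u\<close> or \<open>u - v\<close> rewrites an element of one coset as an element of the
  other.\<close>

lemma YB_class_eqI:
  assumes "N \<ge> 1" "\<And>x. x \<in> cube m N \<Longrightarrow> F x - G x = YB_diff m v x"
  shows "YB_class N F = YB_class N G"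
proof -
  have F: "F x = G x + YB_diff m v x" if "x \<in> cube m N" for x
    using assms(2)[OF that] by (simp add: algebra_simps)
  have 1: "YB_cochain_of N (\<lambda>x. F x + YB_diff m u x)
      = YB_cochain_of N (\<lambda>x. G x + YB_diff m (\<lambda>y. v y + u y) x)" for u
    using assms(1) by (simp add: YB_cochain_of_eq_iff YB_diff_add F)
  have 2: "YB_cochain_of N (\<lambda>x. G x + YB_diff m u x)
      = YB_cochain_of N (\<lambda>x. F x + YB_diff m (\<lambda>y. u y - v y) x)" for u
    using assms(1) by (simp add: YB_cochain_of_eq_iff YB_diff_diff F)
  show ?thesis
    unfolding YB_class_def
    by (intro equalityI image_subsetI; rule range_eqI, (rule 1 | rule 2))
qed

lemma YB_class_eqD:
  assumes "N \<ge> 1" "YB_class N F = YB_class N G"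
  obtains v where "\<And>x. x \<in> cube m N \<Longrightarrow> F x - G x = YB_diff m v x"
proof -
  \<comment> \<open>The parameter \<open>u = 0\<close> exhibits \<open>F\<close> as an element of
    its own coset.\<close>
  have "YB_cochain_of N (\<lambda>x. F x + YB_diff m (\<lambda>y. 0) x) \<in> YB_class N G"
    unfolding assms(2)[symmetric] by (auto simp only: YB_class_def)
  then obtain v where "YB_cochain_of N F = YB_cochain_of N (\<lambda>x. G x + YB_diff m v x)"
    by (auto simp: YB_class_def)
  with assms(1) that[of v] show thesis
    by (simp add: YB_cochain_of_eq_iff)
qed

lemma YB_cocycles_mult:
  "YB_cochain_of N F \<otimes>\<^bsub>YB_cocycles m additive_monoid (int N)\<^esub> YB_cochain_of N G
    = YB_cochain_of N (\<lambda>x. F x + G x)"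
  using YB_cochain_of_mult[of N F G] by (simp add: YB_cocycles_def)

lemma carrier_YB_cohomology_space:
  assumes "N \<ge> 1"
  shows "carrier (YB_cohomology_space (class_ring :: 'a::comm_ring_1 ring) m (int N))
      = YB_class N ` {F. \<forall>x\<in>cube m (Suc N). YB_diff m F x = 0}"
  using assms
  by (auto simp: YB_cohomology_space_def YB_cohomology_def FactGroup_def RCOSETS_def r_coset_def
      carrier_YB_cocycles YB_coboundaries_eq YB_cocycles_mult YB_class_def add.commute image_iff)

lemma zero_YB_cohomology_space:
  assumes "N \<ge> 1"
  shows "\<zero>\<^bsub>YB_cohomology_space (class_ring :: 'a::comm_ring_1 ring) m (int N)\<^esub>
      = YB_class N (\<lambda>x. 0)"
  using assms
  by (simp add: YB_cohomology_space_def YB_cohomology_def FactGroup_def YB_coboundaries_eq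
      YB_class_def)

lemma YB_class_set_mult:
  "YB_class N F <#>\<^bsub>YB_cocycles m additive_monoid (int N)\<^esub> YB_class N G
    = YB_class N (\<lambda>x. F x + G x)" (is "?L = ?R")
proof (intro equalityI subsetI)
  fix f assume "f \<in> ?L"
  then obtain u v where "f = YB_cochain_of N (\<lambda>x. F x + YB_diff m u x + (G x + YB_diff m v x))"
    by (auto simp: set_mult_def YB_class_def YB_cocycles_mult)
  then have "f = YB_cochain_of N (\<lambda>x. F x + G x + YB_diff m (\<lambda>y. u y + v y) x)"
    by (simp add: YB_diff_add algebra_simps)
  then show "f \<in> ?R" by (auto simp: YB_class_def)
next
  fix f assume "f \<in> ?R"
  then obtain u where "f = YB_cochain_of N (\<lambda>x. F x + G x + YB_diff m u x)"
    by (auto simp: YB_class_def)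
  then have "f = YB_cochain_of N (\<lambda>x. F x + YB_diff m u x)
      \<otimes>\<^bsub>YB_cocycles m additive_monoid (int N)\<^esub>
      YB_cochain_of N (\<lambda>x. G x + YB_diff m (\<lambda>y. 0) x)"
    by (simp add: YB_cocycles_mult algebra_simps)
  moreover have "YB_cochain_of N (\<lambda>x. F x + YB_diff m u x) \<in> YB_class N F"
    "YB_cochain_of N (\<lambda>x. G x + YB_diff m (\<lambda>y. 0) x) \<in> YB_class N G"
    unfolding YB_class_def by (rule rangeI)+
  ultimately show "f \<in> ?L" unfolding set_mult_def by blast
qed

lemma add_YB_cohomology_space:
  "YB_class N F \<oplus>\<^bsub>YB_cohomology_space class_ring m (int N)\<^esub> YB_class N G
    = YB_class N (\<lambda>x. F x + G x)"
  by (simp add: YB_cohomology_space_def YB_cohomology_def FactGroup_def YB_class_set_mult)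

text \<open>With \<open>v\<close> from the coset and \<open>u\<close> from the added coboundaries,
  \<open>u + q v\<close> runs over all functions, also for \<open>q = 0\<close>.\<close>

lemma smult_YB_cohomology_space:
  assumes "N \<ge> 1"
  shows "q \<odot>\<^bsub>YB_cohomology_space class_ring m (int N)\<^esub> YB_class N F
      = YB_class N (\<lambda>x. q * F x)" (is "?L = ?R")
proof -
  have L: "f \<in> ?L \<longleftrightarrow>
      (\<exists>u v. f = YB_cochain_of N (\<lambda>x. YB_diff m u x + q * (F x + YB_diff m v x)))" for f
    using assms
    by (auto simp: YB_cohomology_space_def YB_coboundaries_eq set_mult_def YB_class_def
        YB_cochain_of_smult YB_cocycles_mult)
  show ?thesis
  proof (intro equalityI subsetI)
    fix f assume "f \<in> ?L"
    then obtain u v where "f = YB_cochain_of N (\<lambda>x. YB_diff m u x + q * (F x + YB_diff m v x))"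
      unfolding L by blast
    then have "f = YB_cochain_of N (\<lambda>x. q * F x + YB_diff m (\<lambda>y. u y + q * v y) x)"
      by (simp add: YB_diff_add YB_diff_cmult algebra_simps)
    then show "f \<in> ?R" by (auto simp: YB_class_def)
  next
    fix f assume "f \<in> ?R"
    then obtain u where "f = YB_cochain_of N (\<lambda>x. q * F x + YB_diff m u x)"
      by (auto simp: YB_class_def)
    then have "f = YB_cochain_of N (\<lambda>x. YB_diff m u x + q * (F x + YB_diff m (\<lambda>y. 0) x))"
      by (simp add: algebra_simps)
    then show "f \<in> ?L" unfolding L by - (rule exI, rule exI)
  qed
qed

end

section \<open>Transport of vector space structure along a bijection\<close>

lemma linear_map_transport:
  assumes "vectorspace K V" and bij: "bij_betw T (carrier V) (carrier W)"
    and add: "\<And>x y. \<lbrakk>x \<in> carrier V; y \<in> carrier V\<rbrakk> \<Longrightarrow> T (x \<oplus>\<^bsub>V\<^esub> y) = T x \<oplus>\<^bsub>W\<^esub> T y"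
    and smult: "\<And>a x. \<lbrakk>a \<in> carrier K; x \<in> carrier V\<rbrakk> \<Longrightarrow> T (a \<odot>\<^bsub>V\<^esub> x) = a \<odot>\<^bsub>W\<^esub> T x"
    and zero: "T \<zero>\<^bsub>V\<^esub> = \<zero>\<^bsub>W\<^esub>"
  shows "linear_map K V W T"
proof -
  interpret V: vectorspace K V by fact
  \<comment> \<open>Every element of \<open>W\<close> is some \<open>T v\<close>, so the axioms of
    \<open>W\<close> are images of those of \<open>V\<close>.\<close>
  have W: "carrier W = T ` carrier V"
    using bij by (simp add: bij_betw_def)
  have "abelian_group W"
  proof (rule abelian_groupI)
    fix w assume "w \<in> carrier W"
    then obtain v where v: "v \<in> carrier V" "w = T v" by (auto simp: W)
    then have "T (\<ominus>\<^bsub>V\<^esub> v) \<in> carrier W" "T (\<ominus>\<^bsub>V\<^esub> v) \<oplus>\<^bsub>W\<^esub> w = \<zero>\<^bsub>W\<^esub>"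
      by (auto simp: W add[symmetric] zero[symmetric] V.M.l_neg)
    then show "\<exists>y\<in>carrier W. y \<oplus>\<^bsub>W\<^esub> w = \<zero>\<^bsub>W\<^esub>" by blast
  qed (auto simp: W add[symmetric] zero[symmetric] V.M.a_ac)
  then interpret W: abelian_group W .
  have "module K W"
    by unfold_locales
       (auto simp: W add[symmetric] smult[symmetric] V.smult_l_distr V.smult_r_distr V.smult_assoc1)
  then show ?thesis
    by (intro linear_map.intro mod_hom.intro mod_hom_axioms.intro vectorspace.intro
        V.vectorspace_axioms V.module_axioms V.field_axioms)
       (auto simp: LinearCombinations.module_hom_def W add smult)
qed

section \<open>The isomorphism with rational vectors of length \<open>m ^ (n - 1)\<close>\<close>

theorem theorem3p6:
  fixes m :: nat and n :: int
  assumes "m \<ge> 1" and "n \<ge> 1"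
  shows "vectorspace (class_ring :: rat ring) (YB_rational_cohomology m n) \<and>
    vectorspace.fin_dim (class_ring :: rat ring) (YB_rational_cohomology m n) \<and>
    YB_betti m n = m ^ nat (n - 1)"
proof -
  note m = assms(1)
  define M where "M = nat (n - 1)"
  define N where "N = Suc M"
  have n: "n = int N" and N: "N \<ge> 1"
    using assms(2) by (simp_all add: N_def M_def)
  define d where "d = m ^ M"
  let ?V = "module_vec TYPE(rat) d" and ?W = "YB_rational_cohomology m n"
  have W: "?W = YB_cohomology_space class_ring m (int N)"
    by (simp add: YB_rational_cohomology_def n)
  have "card (cube m M) = card {..<d}"
    by (simp add: card_cube d_def)
  \<comment> \<open>Vector coordinates are indexed by the tails of the tuples that start with
    \<open>0\<close>.\<close>
  then obtain e where e: "bij_betw e (cube m M) {..<d}"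
    using finite_same_card_bij[of "cube m M" "{..<d}"] by auto
  define T where "T = (\<lambda>v :: rat vec. YB_class m N (cyc_extend m (\<lambda>y. v $ e y)))"
  have e_less: "e y < d" if "y \<in> cube m M" for y
    using e that by (auto simp: bij_betw_def)
  have e_tl: "e (map (cyc_shift m (- hd x)) (tl x)) < d" if "x \<in> cube m N" for x
    using that m unfolding N_def by (elim in_cube_SucE) (simp add: e_less)
  have cyc_extend_cong: "cyc_extend m v x = cyc_extend m w x"
    if "x \<in> cube m N" "\<And>y. y \<in> cube m M \<Longrightarrow> v y = w y" for v w :: "int list \<Rightarrow> rat" and x
    using that m by (auto simp: N_def cyc_extend_def elim!: in_cube_SucE)
  have class_cong: "YB_class m N F = YB_class m N G"
    if "\<And>x. x \<in> cube m N \<Longrightarrow> F x = G x" for F G :: "int list \<Rightarrow> rat"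
    using that by (intro YB_class_eqI[OF m N, of _ _ "\<lambda>_. 0"]) simp
  interpret V: vec_space "TYPE(rat)" d .
  have "inj_on T (carrier_vec d)"
  proof (rule inj_onI)
    fix v w :: "rat vec"
    assume vw: "v \<in> carrier_vec d" "w \<in> carrier_vec d" "T v = T w"
    \<comment> \<open>The difference of the two invariant representatives is invariant and a
      coboundary, hence zero.\<close>
    define F where "F = cyc_extend m (\<lambda>y. v $ e y - w $ e y)"
    from vw(3) obtain u where u: "\<And>x. x \<in> cube m N \<Longrightarrow> F x = YB_diff m u x"
      unfolding T_def F_def by (rule YB_class_eqD[OF m N]) (auto simp: cyc_extend_def)
    have "cyc_invariant m N F"
      unfolding F_def N_def by (rule cyc_invariant_cyc_extend)
    then have F0: "F x = 0" if "x \<in> cube m N" for x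
      using u that by (rule cyc_invariant_exact_eq_0[OF m])
    show "v = w"
    proof (rule eq_vecI)
      fix i assume "i < dim_vec w"
      then obtain y where y: "y \<in> cube m M" "i = e y"
        using e vw(2) by (auto simp: bij_betw_def)
      have "F (0 # y) = v $ i - w $ i"
        unfolding F_def y(2) by (rule cyc_extend_Cons_0[OF y(1)])
      then show "v $ i = w $ i"
        using F0[of "0 # y"] y(1) m by (simp add: N_def)
    qed (use vw in auto)
  qed
  moreover have "T ` carrier_vec d = carrier ?W"
  proof (intro equalityI subsetI)
    fix X assume "X \<in> T ` carrier_vec d"
    then obtain w where X: "X = YB_class m N (cyc_extend m w)"
      by (auto simp: T_def)
    have "\<forall>x\<in>cube m (Suc N). YB_diff m (cyc_extend m w) x = 0"
      by (simp add: N_def YB_diff_cyc_invariant[OF m cyc_invariant_cyc_extend])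
    then show "X \<in> carrier ?W"
      unfolding X W carrier_YB_cohomology_space[OF m N] by (intro imageI CollectI)
  next
    fix X assume "X \<in> carrier ?W"
    then obtain F where X: "X = YB_class m N F"
        and F: "\<And>x. x \<in> cube m (Suc N) \<Longrightarrow> YB_diff m F x = 0"
      by (auto simp: W carrier_YB_cohomology_space[OF m N])
    \<comment> \<open>The average of \<open>F\<close> is an invariant representative of the class;
      \<open>w\<close> reads off its values on tuples starting with \<open>0\<close>.\<close>
    define w where "w = (\<lambda>y. cyc_average m F (0 # y))"
    define v where "v = vec d (\<lambda>i. w (inv_into (cube m M) e i))"
    from YB_cocycle_minus_average_exact[OF m N F] obtain u
      where "\<And>x. x \<in> cube m N \<Longrightarrow> F x - cyc_average m F x = YB_diff m u x"
      by blast
    then have "X = YB_class m N (cyc_average m F)"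
      unfolding X by (rule YB_class_eqI[OF m N])
    also have "\<dots> = T v"
      unfolding T_def
    proof (rule class_cong)
      fix x assume x: "x \<in> cube m N"
      have "v $ e y = w y" if "y \<in> cube m M" for y
        using that e e_less by (simp add: v_def bij_betw_inv_into_left)
      then have "cyc_extend m (\<lambda>y. v $ e y) x = cyc_extend m w x"
        by (rule cyc_extend_cong[OF x])
      then show "cyc_average m F x = cyc_extend m (\<lambda>y. v $ e y) x"
        using cyc_invariant_eq_cyc_extend[OF m cyc_invariant_cyc_average[OF m]] x
        by (simp add: w_def N_def)
    qed
    finally show "X \<in> T ` carrier_vec d" by (simp add: v_def)
  qed
  ultimately have bij: "bij_betw T (carrier ?V) (carrier ?W)"
    by (simp add: bij_betw_def module_vec_simps)
  have lin: "linear_map class_ring ?V ?W T"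
  proof (rule linear_map_transport[OF vec_vs bij])
    fix v w assume "v \<in> carrier ?V" "w \<in> carrier ?V"
    then show "T (v \<oplus>\<^bsub>?V\<^esub> w) = T v \<oplus>\<^bsub>?W\<^esub> T w"
      unfolding T_def W add_YB_cohomology_space[OF m]
      by (intro class_cong) (simp add: module_vec_simps cyc_extend_def e_tl)
  next
    fix a v assume "v \<in> carrier ?V"
    then show "T (a \<odot>\<^bsub>?V\<^esub> v) = a \<odot>\<^bsub>?W\<^esub> T v"
      unfolding T_def W smult_YB_cohomology_space[OF m N]
      by (intro class_cong) (simp add: module_vec_simps cyc_extend_def e_tl)
  next
    show "T \<zero>\<^bsub>?V\<^esub> = \<zero>\<^bsub>?W\<^esub>"
      unfolding T_def W zero_YB_cohomology_space[OF m N]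
      by (intro class_cong) (simp add: module_vec_simps cyc_extend_def e_tl)
  qed
  interpret T: linear_map class_ring ?V ?W T by (rule lin)
  have "vectorspace.dim class_ring ?W = d"
    using T.dim_eq bij V.dim_is_n by (simp add: bij_betw_def)
  moreover have "vectorspace.fin_dim class_ring ?W"
    using T.surj_fin_dim bij by (simp add: bij_betw_def)
  ultimately show ?thesis
    using T.W.vectorspace_axioms by (simp add: YB_betti_def d_def M_def)
qed

end
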